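(* Let $M^m$ be a compact $m$-dimensional manifold and let $h:M^m\to\mathbb R^n$ be a substantial $C^1$ immersion. Then each point in the boundary of $\operatorname{Conv}[h(M^m)]$ admits at most $n-m$ supporting hyperplanes in general position.
   Context: Manifolds are connected and without boundary. $\operatorname{Conv}(A)$ denotes the convex hull of $A\subset\mathbb R^n$, and its boundary is its topological boundary in $\mathbb R^n$. The map $h$ is substantial if $h(M)$ is not contained in a proper affine subspace of $\mathbb R^n$. A supporting hyperplane of $C=\operatorname{Conv}[h(M)]$ at a boundary point $p$ is an affine hyperplane through $p$ such that $C$ is contained in one of the two closed half-spaces it bounds. Hyperplanes $H_1,\dots,H_s$ through $p$ are in general position if their unit normal vectors are linearly independent. "Admits at most $n-m$ supporting hyperplanes in general position" means: whenever $H_1,\dots,H_s$ are supporting hyperplanes at $p$ in general position, $s\le n-m$. *)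

theory Defs
  imports "HOL-Analysis.Analysis"
begin

text \<open>On an open set \<open>S\<close> the derivative is unique, so \<open>D\<close> below is the Frechet derivative of \<open>f\<close>,
  continuous with respect to the operator norm.\<close>

definition C1_on :: "('a::real_normed_vector \<Rightarrow> 'b::real_normed_vector) \<Rightarrow> 'a set \<Rightarrow> bool" where
  "C1_on f S \<longleftrightarrow>
     (\<exists>D :: 'a \<Rightarrow> 'a \<Rightarrow>\<^sub>L 'b.
        (\<forall>x\<in>S. (f has_derivative blinfun_apply (D x)) (at x)) \<and> continuous_on S D)"

text \<open>A chart is a pair of its domain and its coordinate map; only the values of the map on the
  domain matter, and \<open>inv_into U \<phi>\<close> is the inverse of the chart on \<open>\<phi> ` U\<close>.
  Compatibility is only asked to be \<open>C\<^sup>1\<close>, the least regularity for which \<open>C\<^sup>1\<close> immersions make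
  sense; every smooth atlas is in particular such an atlas.\<close>

definition C1_atlas :: "'a topology \<Rightarrow> ('a set \<times> ('a \<Rightarrow> real ^ 'm)) set \<Rightarrow> bool" where
  "C1_atlas M A \<longleftrightarrow>
     (\<Union>(U, \<phi>)\<in>A. U) = topspace M \<and>
     (\<forall>(U, \<phi>)\<in>A. openin M U \<and> open (\<phi> ` U) \<and>
        homeomorphic_map (subtopology M U) (top_of_set (\<phi> ` U)) \<phi>) \<and>
     (\<forall>(U, \<phi>)\<in>A. \<forall>(V, \<psi>)\<in>A. C1_on (\<psi> \<circ> inv_into U \<phi>) (\<phi> ` (U \<inter> V)))"

text \<open>Connected manifolds without boundary, of dimension \<open>CARD('m)\<close>.\<close>

definition C1_manifold :: "'a topology \<Rightarrow> ('a set \<times> ('a \<Rightarrow> real ^ 'm)) set \<Rightarrow> bool" where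
  "C1_manifold M A \<longleftrightarrow>
     Hausdorff_space M \<and> second_countable M \<and> connected_space M \<and> C1_atlas M A"

definition C1_immersion :: "('a set \<times> ('a \<Rightarrow> real ^ 'm)) set \<Rightarrow> ('a \<Rightarrow> real ^ 'n) \<Rightarrow> bool" where
  "C1_immersion A h \<longleftrightarrow>
     (\<forall>(U, \<phi>)\<in>A. C1_on (h \<circ> inv_into U \<phi>) (\<phi> ` U) \<and>
        (\<forall>x\<in>\<phi> ` U. inj (frechet_derivative (h \<circ> inv_into U \<phi>) (at x))))"

definition substantial :: "'a topology \<Rightarrow> ('a \<Rightarrow> real ^ 'n) \<Rightarrow> bool" where
  "substantial M h \<longleftrightarrow> \<not> (\<exists>E. affine E \<and> E \<noteq> UNIV \<and> h ` topspace M \<subseteq> E)"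

definition supporting_hyperplane ::
  "(real ^ 'n) set \<Rightarrow> real ^ 'n \<Rightarrow> (real ^ 'n) set \<Rightarrow> bool" where
  "supporting_hyperplane C p H \<longleftrightarrow>
     (\<exists>a b. a \<noteq> 0 \<and> H = {x. a \<bullet> x = b} \<and> p \<in> H \<and>
        (C \<subseteq> {x. a \<bullet> x \<le> b} \<or> C \<subseteq> {x. a \<bullet> x \<ge> b}))"

definition unit_normal :: "(real ^ 'n) set \<Rightarrow> real ^ 'n \<Rightarrow> bool" where
  "unit_normal H v \<longleftrightarrow> norm v = 1 \<and> (\<exists>b. H = {x. v \<bullet> x = b})"

text \<open>Linear independence of the family \<open>v 1, \<dots>, v s\<close>: injectivity excludes repeated members,
  which \<open>independent\<close> cannot see in the image set. A hyperplane determines its unit normal up to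
  sign, and the choice of signs does not affect independence.\<close>

definition general_position :: "nat \<Rightarrow> (nat \<Rightarrow> (real ^ 'n) set) \<Rightarrow> bool" where
  "general_position s H \<longleftrightarrow>
     (\<exists>v. (\<forall>i\<in>{1..s}. unit_normal (H i) (v i)) \<and>
        inj_on v {1..s} \<and> independent (v ` {1..s}))"

end

theory Submission
  imports Defs
begin

text \<open>The boundary point \<open>p\<close> lies in the compact convex set \<open>C = Conv[h(M)]\<close>, so it is a convex
  combination of finitely many points \<open>h x\<^sub>i\<close> with positive weights. A supporting hyperplane of \<open>C\<close>
  at \<open>p\<close> contains all these points, so its normal is orthogonal to the image of \<open>dh\<close> at each \<open>x\<^sub>i\<close>.
  Hence all normals lie in the orthogonal complement of one \<open>m\<close>-dimensional subspace.\<close>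

lemma supporting_functional_convex_hull:
  fixes S :: "'a::euclidean_space set"
  assumes "p \<in> convex hull S"
  obtains q where "q \<in> S"
    "\<And>a. \<forall>x\<in>convex hull S. a \<bullet> x \<le> a \<bullet> p \<Longrightarrow> a \<bullet> q = a \<bullet> p"
proof -
  obtain T u where T: "finite T" "T \<subseteq> S" and u: "\<forall>x\<in>T. 0 \<le> u x" "sum u T = 1"
    and p: "(\<Sum>x\<in>T. u x *\<^sub>R x) = p"
    using assms unfolding convex_hull_explicit by blast
  \<comment> \<open>Any point of nonzero weight will do. It is fixed before \<open>a\<close>, so the
    same \<open>q\<close> serves all functionals that are maximal at \<open>p\<close>; one such
    point is enough for the dimension count.\<close>
  obtain q where q: "q \<in> T" "u q \<noteq> 0"
    using u(2) by (metis sum.neutral zero_neq_one)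
  show thesis
  proof
    show "q \<in> S" using q T by blast
    fix a assume a: "\<forall>x\<in>convex hull S. a \<bullet> x \<le> a \<bullet> p"
    have nonneg: "0 \<le> u x * (a \<bullet> p - a \<bullet> x)" if "x \<in> T" for x
      using that u(1) a T(2) hull_subset[of S convex] by (auto intro!: mult_nonneg_nonneg)
    \<comment> \<open>The weighted gaps \<open>a \<bullet> p - a \<bullet> x\<close> are nonnegative
      and average to zero, so each of them vanishes where the weight does not.\<close>
    have "(\<Sum>x\<in>T. u x * (a \<bullet> p - a \<bullet> x)) = a \<bullet> p * sum u T - a \<bullet> (\<Sum>x\<in>T. u x *\<^sub>R x)"
      by (simp add: inner_sum_right right_diff_distrib sum_subtractf sum_distrib_left sum_distrib_right
        mult.commute)
    then have "(\<Sum>x\<in>T. u x * (a \<bullet> p - a \<bullet> x)) = 0"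
      using u(2) p by simp
    then have "u q * (a \<bullet> p - a \<bullet> q) = 0"
      using sum_nonneg_eq_0_iff[OF T(1) nonneg] q(1) by auto
    then show "a \<bullet> q = a \<bullet> p" using q(2) by simp
  qed
qed

text \<open>Fermat's condition for the height function of \<open>g\<close> in direction
  \<open>a\<close>. It turns a supporting hyperplane touching an immersed patch into one whose
  normal is orthogonal to the tangent space.\<close>

lemma inner_derivative_eq_0_at_max:
  fixes g :: "'a::euclidean_space \<Rightarrow> 'b::euclidean_space"
  assumes "(g has_derivative D) (at x)" "open W" "x \<in> W"
    and "\<forall>y\<in>W. a \<bullet> g y \<le> a \<bullet> g x"
  shows "a \<bullet> D v = 0"
proof -
  have "((\<lambda>y. a \<bullet> g y) has_derivative (\<lambda>v. a \<bullet> D v)) (at x)"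
    using assms(1) by (rule has_derivative_inner_right)
  from differential_zero_maxmin[OF assms(3,2) this] assms(4)
  show ?thesis by (metis (no_types, lifting))
qed

lemma C1_on_imp_continuous_on:
  assumes "C1_on f S"
  shows "continuous_on S f"
  using assms unfolding C1_on_def
  by (meson continuous_at_imp_continuous_on has_derivative_continuous)

lemma C1_on_has_frechet_derivative:
  assumes "C1_on f S" "x \<in> S"
  shows "(f has_derivative frechet_derivative f (at x)) (at x)"
  using assms unfolding C1_on_def by (metis frechet_derivative_at)

lemma C1_atlas_chart:
  assumes "C1_atlas M A" "(U, \<phi>) \<in> A"
  shows "openin M U" "open (\<phi> ` U)" "inj_on \<phi> U"
    "continuous_map (subtopology M U) (top_of_set (\<phi> ` U)) \<phi>"
proof -
  have *: "openin M U" "open (\<phi> ` U)"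
    "homeomorphic_map (subtopology M U) (top_of_set (\<phi> ` U)) \<phi>"
    using assms unfolding C1_atlas_def by auto
  then show "openin M U" "open (\<phi> ` U)" by auto
  have "topspace (subtopology M U) = U"
    using openin_subset[OF *(1)] by auto
  then show "inj_on \<phi> U"
    using *(3) by (metis homeomorphic_imp_injective_map)
  show "continuous_map (subtopology M U) (top_of_set (\<phi> ` U)) \<phi>"
    using *(3) by (rule homeomorphic_imp_continuous_map)
qed

lemma C1_atlas_covers:
  assumes "C1_atlas M A" "x \<in> topspace M"
  obtains U \<phi> where "(U, \<phi>) \<in> A" "x \<in> U"
proof -
  have "(\<Union>(U, \<phi>)\<in>A. U) = topspace M"
    using assms(1) unfolding C1_atlas_def by (rule conjunct1)
  with assms(2) have "x \<in> (\<Union>(U, \<phi>)\<in>A. U)" by simp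
  then show thesis using that by auto
qed

text \<open>Continuity is local, and on a chart domain \<open>h\<close> is the coordinate expression
  composed with the chart. This makes the image of a compact manifold compact.\<close>

lemma C1_immersion_imp_continuous_map:
  fixes h :: "'a \<Rightarrow> real ^ 'n"
  assumes "C1_atlas M A" "C1_immersion A h"
  shows "continuous_map M euclidean h"
  unfolding continuous_map_def
proof (intro conjI allI impI)
  fix W :: "(real ^ 'n) set" assume "openin euclidean W"
  show "openin M {x \<in> topspace M. h x \<in> W}"
  proof (subst openin_subopen, intro ballI)
    fix x assume x: "x \<in> {x \<in> topspace M. h x \<in> W}"
    then have "x \<in> topspace M" by simp
    then obtain U \<phi> where U: "(U, \<phi>) \<in> A" "x \<in> U"
      by (rule C1_atlas_covers[OF assms(1)])
    note chart = C1_atlas_chart[OF assms(1) U(1)]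
    have "C1_on (h \<circ> inv_into U \<phi>) (\<phi> ` U)"
      using assms(2) U(1) unfolding C1_immersion_def by auto
    then have "continuous_map (top_of_set (\<phi> ` U)) euclidean (h \<circ> inv_into U \<phi>)"
      unfolding continuous_map_iff_continuous by (rule C1_on_imp_continuous_on)
    with chart(4) have "continuous_map (subtopology M U) euclidean ((h \<circ> inv_into U \<phi>) \<circ> \<phi>)"
      by (rule continuous_map_compose)
    then have "openin (subtopology M U)
        {y \<in> topspace (subtopology M U). ((h \<circ> inv_into U \<phi>) \<circ> \<phi>) y \<in> W}"
      using \<open>openin euclidean W\<close> by (rule openin_continuous_map_preimage)
    also have "{y \<in> topspace (subtopology M U). ((h \<circ> inv_into U \<phi>) \<circ> \<phi>) y \<in> W} = {y \<in> U. h y \<in> W}"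
      using chart(3) openin_subset[OF chart(1)] by auto
    finally have "openin M {y \<in> U. h y \<in> W}"
      using chart(1) openin_trans_full by blast
    moreover have "{y \<in> U. h y \<in> W} \<subseteq> {x \<in> topspace M. h x \<in> W}"
      using openin_subset[OF chart(1)] by auto
    ultimately show "\<exists>T. openin M T \<and> x \<in> T \<and> T \<subseteq> {x \<in> topspace M. h x \<in> W}"
      using x U(2) by blast
  qed
qed simp

text \<open>The normal \<open>a\<close> from the supporting property and the unit normal
  \<open>v\<close> describe the same \<open>H\<close>, so \<open>v\<close> is a multiple of
  \<open>a\<close>; the sign of the factor decides which alternative holds.\<close>

lemma supporting_hyperplane_unit_normal:
  assumes "supporting_hyperplane C p H" "unit_normal H v"
  shows "(\<forall>x\<in>C. v \<bullet> x \<le> v \<bullet> p) \<or> (\<forall>x\<in>C. v \<bullet> p \<le> v \<bullet> x)"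
proof -
  obtain a b where a: "a \<noteq> 0" "H = {x. a \<bullet> x = b}" "a \<bullet> p = b"
    and C: "C \<subseteq> {x. a \<bullet> x \<le> b} \<or> C \<subseteq> {x. a \<bullet> x \<ge> b}"
    using assms(1) unfolding supporting_hyperplane_def by auto
  obtain c where v: "norm v = 1" "H = {x. v \<bullet> x = c}"
    using assms(2) unfolding unit_normal_def by auto
  \<comment> \<open>Moving from \<open>p\<close> in a direction orthogonal to \<open>a\<close> stays
    in \<open>H\<close>, where \<open>v\<close> is constant.\<close>
  have perp: "v \<bullet> w = 0" if "a \<bullet> w = 0" for w
  proof -
    have "p \<in> H" "p + w \<in> H" using a that by (auto simp: inner_add_right)
    then show ?thesis using v by (auto simp: inner_add_right)
  qed
  \<comment> \<open>With this factor, \<open>perp\<close> applied to \<open>w\<close> minus its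
    projection onto \<open>a\<close> gives
    \<open>v \<bullet> w = k * (a \<bullet> w)\<close>.\<close>
  define k where "k = (v \<bullet> a) / (a \<bullet> a)"
  have k: "v \<bullet> w = k * (a \<bullet> w)" for w
  proof -
    have "v \<bullet> (w - ((a \<bullet> w) / (a \<bullet> a)) *\<^sub>R a) = 0"
      using a(1) by (intro perp) (simp add: inner_diff_right)
    then show ?thesis by (simp add: inner_diff_right k_def)
  qed
  show ?thesis
  proof (cases "k \<ge> 0")
    case True
    then show ?thesis using C a(3) by (auto simp: k intro!: mult_left_mono)
  next
    case False
    then show ?thesis using C a(3) by (auto simp: k intro!: mult_left_mono_neg)
  qed
qed

text \<open>The bound is stated over the integers because subtraction of naturals is cut off at
  0.\<close>

theorem corollary1p5:
  fixes M :: "'a topology"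
    and A :: "('a set \<times> ('a \<Rightarrow> real ^ 'm)) set"
    and h :: "'a \<Rightarrow> real ^ 'n"
  assumes "C1_manifold M A"
    and "compact_space M"
    and "C1_immersion A h"
    and "substantial M h"
  shows "\<forall>p \<in> frontier (convex hull (h ` topspace M)). \<forall>s H.
           (\<forall>i\<in>{1..s}. supporting_hyperplane (convex hull (h ` topspace M)) p (H i)) \<and>
           general_position s H \<longrightarrow>
           int s \<le> int CARD('n) - int CARD('m)"
proof (intro ballI allI impI, elim conjE)
  let ?C = "convex hull (h ` topspace M)"
  fix p s and H :: "nat \<Rightarrow> (real ^ 'n) set"
  assume p: "p \<in> frontier ?C"
    and supp: "\<forall>i\<in>{1..s}. supporting_hyperplane ?C p (H i)"
    and "general_position s H"
  then obtain v where v: "\<And>i. i \<in> {1..s} \<Longrightarrow> unit_normal (H i) (v i)"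
    "inj_on v {1..s}" "independent (v ` {1..s})"
    unfolding general_position_def by blast
  have atlas: "C1_atlas M A" using assms(1) unfolding C1_manifold_def by blast
  \<comment> \<open>Compactness makes the hull closed, so the frontier point \<open>p\<close>
    belongs to it and is a convex combination of image points.\<close>
  have "compactin M (topspace M)" using assms(2) by (simp add: compact_space_def)
  then have "compact (h ` topspace M)"
    using image_compactin[OF _ C1_immersion_imp_continuous_map[OF atlas assms(3)]] by auto
  then have "closed ?C" by (intro compact_imp_closed compact_convex_hull)
  then have "p \<in> ?C" using p frontier_subset_closed by blast
  then obtain q where q: "q \<in> h ` topspace M"
    "\<And>a. \<forall>x\<in>?C. a \<bullet> x \<le> a \<bullet> p \<Longrightarrow> a \<bullet> q = a \<bullet> p"
    using supporting_functional_convex_hull by blast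
  obtain x where x_in: "q = h x" "x \<in> topspace M" using q(1) by blast
  obtain U \<phi> where "(U, \<phi>) \<in> A" "x \<in> U"
    using C1_atlas_covers[OF atlas x_in(2)] .
  note x = x_in(1) this
  note chart = C1_atlas_chart[OF atlas x(2)]
  define g where "g = h \<circ> inv_into U \<phi>"
  define D where "D = frechet_derivative g (at (\<phi> x))"
  have "C1_on g (\<phi> ` U)" "inj D"
    using assms(3) x unfolding C1_immersion_def g_def D_def by auto
  then have D: "(g has_derivative D) (at (\<phi> x))"
    unfolding D_def using x(3) by (intro C1_on_has_frechet_derivative) auto
  have g: "g (\<phi> x) = q" using x chart(3) by (simp add: g_def)
  have g_in: "g y \<in> ?C" if "y \<in> \<phi> ` U" for y
  proof (rule hull_inc)
    show "g y \<in> h ` topspace M"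
      using that chart(3) openin_subset[OF chart(1)] by (auto simp: g_def)
  qed
  \<comment> \<open>The height in direction \<open>a\<close> is at most
    \<open>a \<bullet> p = a \<bullet> q\<close> on the hull, so along the chart it is maximal at
    \<open>\<phi> x\<close>.\<close>
  have perp: "a \<bullet> w = 0" if a: "\<forall>x\<in>?C. a \<bullet> x \<le> a \<bullet> p" and w: "w \<in> range D" for a w
  proof -
    have "\<forall>y\<in>\<phi> ` U. a \<bullet> g y \<le> a \<bullet> g (\<phi> x)"
      unfolding g q(2)[OF a] using a g_in by blast
    then have "a \<bullet> D u = 0" for u
      using inner_derivative_eq_0_at_max[OF D chart(2)] x(3) by blast
    then show ?thesis using w by blast
  qed
  \<comment> \<open>The hull may lie on either side of the hyperplane; \<open>perp\<close> is
    applied to \<open>v i\<close> or to \<open>- v i\<close>.\<close>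
  have orth: "v i \<bullet> w = 0" if "i \<in> {1..s}" "w \<in> range D" for i w
    using supporting_hyperplane_unit_normal[OF supp[rule_format, OF that(1)] v(1)[OF that(1)]]
  proof
    assume "\<forall>x\<in>?C. v i \<bullet> x \<le> v i \<bullet> p"
    then show ?thesis using that(2) by (rule perp)
  next
    assume "\<forall>x\<in>?C. v i \<bullet> p \<le> v i \<bullet> x"
    then have "\<forall>x\<in>?C. - v i \<bullet> x \<le> - v i \<bullet> p" by simp
    then have "- v i \<bullet> w = 0" using that(2) by (rule perp)
    then show ?thesis by simp
  qed
  have lin: "linear D" using D by (rule has_derivative_linear)
  have dimD: "dim (range D) = CARD('m)"
    using dim_image_eq[OF lin, of UNIV] \<open>inj D\<close> by simp
  \<comment> \<open>The \<open>s\<close> independent normals lie in the orthogonal complement of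
    \<open>range D\<close>; injectivity of \<open>v\<close> ensures that the image set really has
    \<open>s\<close> elements.\<close>
  have "v ` {1..s} \<subseteq> {y. \<forall>w\<in>range D. orthogonal w y}"
    using orth by (auto simp: orthogonal_def inner_commute)
  from dim_subset[OF this] have "card (v ` {1..s}) \<le> dim {y. \<forall>w\<in>range D. orthogonal w y}"
    unfolding dim_eq_card_independent[OF v(3)] .
  moreover have "card (v ` {1..s}) = s" using v(2) by (simp add: card_image)
  moreover have "dim {y. \<forall>w\<in>range D. orthogonal w y} + dim (range D) = CARD('n)"
    using dim_subspace_orthogonal_to_vectors[of "range D" UNIV] lin
    by (simp add: linear_subspace_image)
  ultimately show "int s \<le> int CARD('n) - int CARD('m)" using dimD by linarith
qed

end
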